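(* Let $(X,d)$ be a complete semimetric space with a continuous triangle function $\Phi\colon\mathbb{R}^+\times\mathbb{R}^+\to\mathbb{R}^+$, and suppose that the semimetric $d$ is continuous. Let $T\colon X\to X$ be a mapping satisfying, with some $\beta\ge 0$, $$d(Tx,Ty)\le\beta\max\{d(x,Ty),d(y,Tx)\}\quad\text{for all }x,y\in X.$$ Suppose that: (1) $\Phi(ku,kv)=k\,\Phi(u,v)$ for all $k,u,v\in\mathbb{R}^+$. (2) For every $0\le a<1$ there exists $C(a)>0$ such that for every positive integer $p$ $$\Phi(1,\Phi(a,\Phi(a^2,\ldots,\Phi(a^{p-1},a^{p}))))\le C(a).$$ (3) $\Phi(0,\beta)<1$. (4) If $\beta>0$, then $\Psi^{-1}(1/\beta)>1$, where $\Psi(u)=\Phi(u,1)$ and $\Psi^{-1}$ denotes the generalized inverse of the non-decreasing function $\Psi$. Then $T$ has a fixed point. If $0\le\beta<1$, then the fixed point is unique.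
   Context: $\mathbb{R}^+=[0,\infty)$. A semimetric space $(X,d)$ is a nonempty set $X$ with a function $d\colon X\times X\to\mathbb{R}^+$ such that for all $x,y\in X$: $d(x,y)=0$ if and only if $x=y$, and $d(x,y)=d(y,x)$. A function $\Phi\colon\mathbb{R}^+\times\mathbb{R}^+\to\mathbb{R}^+$ is a triangle function for $d$ if $\Phi$ is symmetric and non-decreasing in both of its arguments, $\Phi(0,0)=0$, and $d(x,y)\le\Phi(d(x,z),d(z,y))$ for all $x,y,z\in X$. A sequence $(x_n)$ in $X$ converges to $x\in X$ if $d(x_n,x)\to 0$; it is Cauchy if $d(x_n,x_m)\to 0$ as $n,m\to\infty$; $(X,d)$ is complete if every Cauchy sequence converges to some point of $X$. The semimetric $d$ is continuous if $x_n\to x$ and $y_n\to y$ imply $d(x_n,y_n)\to d(x,y)$. In condition (2) the expression is nested: for $p=1$ it is $\Phi(1,a)$, for $p=2$ it is $\Phi(1,\Phi(a,a^2))$, and so on. The generalized inverse of a non-decreasing function $\Psi$ is $\Psi^{-1}(\tau)=\inf\{t : \Psi(t)\ge\tau\}$, with the convention that the infimum of the empty set is $\infty$ (so $\Psi^{-1}$ takes values in $[0,\infty]$). *)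

theory Defs
  imports "HOL-Analysis.Analysis"
begin

locale semimetric_space =
  fixes X :: "'a set" and d :: "'a \<Rightarrow> 'a \<Rightarrow> real"
  assumes nonempty: "X \<noteq> {}"
    and nonneg: "\<And>x y. x \<in> X \<Longrightarrow> y \<in> X \<Longrightarrow> 0 \<le> d x y"
    and zero_iff: "\<And>x y. x \<in> X \<Longrightarrow> y \<in> X \<Longrightarrow> d x y = 0 \<longleftrightarrow> x = y"
    and commute: "\<And>x y. x \<in> X \<Longrightarrow> y \<in> X \<Longrightarrow> d x y = d y x"
begin

definition converges_to :: "(nat \<Rightarrow> 'a) \<Rightarrow> 'a \<Rightarrow> bool" where
  "converges_to s x \<longleftrightarrow> range s \<subseteq> X \<and> x \<in> X \<and> (\<lambda>n. d (s n) x) \<longlonglongrightarrow> 0"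

definition Cauchy_seq :: "(nat \<Rightarrow> 'a) \<Rightarrow> bool" where
  "Cauchy_seq s \<longleftrightarrow> range s \<subseteq> X \<and> (\<forall>\<epsilon>>0. \<exists>N. \<forall>n\<ge>N. \<forall>m\<ge>N. d (s n) (s m) < \<epsilon>)"

definition complete_space :: bool where
  "complete_space \<longleftrightarrow> (\<forall>s. Cauchy_seq s \<longrightarrow> (\<exists>x\<in>X. converges_to s x))"

definition continuous_semimetric :: bool where
  "continuous_semimetric \<longleftrightarrow>
     (\<forall>s t x y. converges_to s x \<longrightarrow> converges_to t y \<longrightarrow> (\<lambda>n. d (s n) (t n)) \<longlonglongrightarrow> d x y)"

text \<open>A function on \<open>[0,\<infinity>) \<times> [0,\<infinity>)\<close> is represented by a curried real function of which only
  the values at nonnegative arguments are constrained.\<close>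

definition triangle_function :: "(real \<Rightarrow> real \<Rightarrow> real) \<Rightarrow> bool" where
  "triangle_function \<Phi> \<longleftrightarrow>
     (\<forall>u\<ge>0. \<forall>v\<ge>0. 0 \<le> \<Phi> u v) \<and>
     (\<forall>u\<ge>0. \<forall>v\<ge>0. \<Phi> u v = \<Phi> v u) \<and>
     (\<forall>u\<ge>0. mono_on {0..} (\<lambda>v. \<Phi> u v)) \<and>
     (\<forall>v\<ge>0. mono_on {0..} (\<lambda>u. \<Phi> u v)) \<and>
     \<Phi> 0 0 = 0 \<and>
     (\<forall>x\<in>X. \<forall>y\<in>X. \<forall>z\<in>X. d x y \<le> \<Phi> (d x z) (d z y))"

end

text \<open>\<open>nested_from \<Phi> a i n = \<Phi>(a^i, \<Phi>(a^(i+1), \<dots>, \<Phi>(a^(i+n-1), a^(i+n))))\<close>, with \<open>n\<close>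
  applications of \<open>\<Phi>\<close>.\<close>

primrec nested_from :: "(real \<Rightarrow> real \<Rightarrow> real) \<Rightarrow> real \<Rightarrow> nat \<Rightarrow> nat \<Rightarrow> real" where
  "nested_from \<Phi> a i 0 = a ^ i"
| "nested_from \<Phi> a i (Suc n) = \<Phi> (a ^ i) (nested_from \<Phi> a (Suc i) n)"

definition nested :: "(real \<Rightarrow> real \<Rightarrow> real) \<Rightarrow> real \<Rightarrow> nat \<Rightarrow> real" where
  "nested \<Phi> a p = nested_from \<Phi> a 0 p"

lemma nested_1: "nested \<Phi> a 1 = \<Phi> 1 a"
  by (simp add: nested_def)

lemma nested_2: "nested \<Phi> a 2 = \<Phi> 1 (\<Phi> a (a ^ 2))"
  by (simp add: nested_def numeral_2_eq_2)

text \<open>Generalized inverse of a function on \<open>[0,\<infinity>)\<close>; the infimum of the empty set in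
  \<^typ>\<open>ereal\<close> is \<open>\<infinity>\<close>.\<close>

definition generalized_inverse :: "(real \<Rightarrow> real) \<Rightarrow> real \<Rightarrow> ereal" where
  "generalized_inverse \<Psi> \<tau> = (INF t \<in> {t. 0 \<le> t \<and> \<tau> \<le> \<Psi> t}. ereal t)"

end

theory Submission
  imports Defs
begin

text \<open>
  The fixed point is the limit of a Picard orbit \<open>s n = (T ^^ n) z\<close>. Comparing \<open>T\<close> at two
  consecutive orbit points, one of the two cross distances is \<open>d (s (n+1)) (s (n+1)) = 0\<close>, so
  the contraction condition and the triangle function give
  \<open>d (s (n+1)) (s (n+2)) \<le> \<beta> * \<Phi> u v\<close>, where \<open>u\<close> is the previous step and \<open>v\<close> the present one.
  Homogeneity turns \<open>\<Phi> v v\<close> into \<open>v * \<Phi> 1 1\<close>, and the condition on the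
  generalized inverse gives \<open>\<beta> * \<Phi> 1 1 < 1\<close>: steps cannot grow, and therefore they shrink at
  the geometric rate \<open>a = \<beta> * \<Phi> 1 1\<close> (lemma \<open>implicit_step_bound\<close>).

  Iterating the triangle function along the orbit bounds a distance by a nested expression in
  the steps. With geometric steps, homogeneity extracts the factor \<open>a ^ n\<close> and leaves the
  expressions \<open>nested \<Phi> a p\<close>, which are bounded uniformly in \<open>p\<close>, so the orbit is Cauchy
  (lemma \<open>Cauchy_seq_if_geometric_steps\<close>).

  At the limit \<open>x\<close>, continuity of \<open>d\<close> passes the contraction condition to
  \<open>D \<le> \<beta> * D\<close> with \<open>D = d x (T x)\<close>. The degenerate triangle \<open>x, x, T x\<close> gives
  \<open>D \<le> \<Phi> 0 D\<close>, hence \<open>D \<le> \<Phi> 0 (\<beta> * D) = D * \<Phi> 0 \<beta>\<close>, and \<open>\<Phi> 0 \<beta> < 1\<close> forces \<open>D = 0\<close>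
  (lemma \<open>eq_if_dist_le_mult_dist\<close>). Two fixed points also satisfy \<open>d x y \<le> \<beta> * d x y\<close>, and
  coincide for the same reason.
\<close>

section \<open>Homogeneous triangle functions\<close>

lemma nested_from_nonneg:
  assumes "\<And>u v. 0 \<le> u \<Longrightarrow> 0 \<le> v \<Longrightarrow> 0 \<le> \<Phi> u v" and "0 \<le> a"
  shows "0 \<le> nested_from \<Phi> a i n"
  using assms by (induction n arbitrary: i) auto

lemma nested_from_eq_power_mult_nested:
  assumes nonneg: "\<And>u v. 0 \<le> u \<Longrightarrow> 0 \<le> v \<Longrightarrow> 0 \<le> \<Phi> u v"
    and hom: "\<And>k u v. 0 \<le> k \<Longrightarrow> 0 \<le> u \<Longrightarrow> 0 \<le> v \<Longrightarrow> \<Phi> (k * u) (k * v) = k * \<Phi> u v"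
    and a: "0 \<le> a"
  shows "nested_from \<Phi> a i n = a ^ i * nested \<Phi> a n"
proof -
  have shift: "nested_from \<Phi> a (i + j) n = a ^ i * nested_from \<Phi> a j n" for j
  proof (induction n arbitrary: j)
    case (Suc n)
    have "nested_from \<Phi> a (i + j) (Suc n)
        = \<Phi> (a ^ i * a ^ j) (a ^ i * nested_from \<Phi> a (Suc j) n)"
      using Suc.IH[of "Suc j"] by (simp add: power_add)
    also have "\<dots> = a ^ i * \<Phi> (a ^ j) (nested_from \<Phi> a (Suc j) n)"
      using a by (intro hom nested_from_nonneg nonneg) auto
    finally show ?case by simp
  qed (simp add: power_add)
  from shift[of 0] show ?thesis by (simp add: nested_def)
qed

text \<open>If \<open>\<Psi>\<close> reached the level \<open>\<tau>\<close> at \<open>t\<close>, the infimum would be at most \<open>t\<close>.\<close>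

lemma less_if_less_generalized_inverse:
  assumes "ereal t < generalized_inverse \<Psi> \<tau>" and "0 \<le> t"
  shows "\<Psi> t < \<tau>"
proof (rule ccontr)
  assume "\<not> \<Psi> t < \<tau>"
  with assms(2) have "generalized_inverse \<Psi> \<tau> \<le> ereal t"
    unfolding generalized_inverse_def by (intro INF_lower) auto
  with assms(1) show False by simp
qed

context semimetric_space
begin

lemma triangle_functionD:
  assumes "triangle_function \<Phi>"
  shows "\<And>u v. 0 \<le> u \<Longrightarrow> 0 \<le> v \<Longrightarrow> 0 \<le> \<Phi> u v"
    and "\<And>u u' v v'. 0 \<le> u \<Longrightarrow> u \<le> u' \<Longrightarrow> 0 \<le> v \<Longrightarrow> v \<le> v' \<Longrightarrow> \<Phi> u v \<le> \<Phi> u' v'"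
    and "\<And>x y z. x \<in> X \<Longrightarrow> y \<in> X \<Longrightarrow> z \<in> X \<Longrightarrow> d x y \<le> \<Phi> (d x z) (d z y)"
proof -
  show "0 \<le> \<Phi> u v" if "0 \<le> u" "0 \<le> v" for u v
    using assms that by (auto simp: triangle_function_def)
  show "d x y \<le> \<Phi> (d x z) (d z y)" if "x \<in> X" "y \<in> X" "z \<in> X" for x y z
    using assms that by (auto simp: triangle_function_def)
  show "\<Phi> u v \<le> \<Phi> u' v'" if "0 \<le> u" "u \<le> u'" "0 \<le> v" "v \<le> v'" for u u' v v'
  proof -
    have mono: "mono_on {0..} (\<lambda>v. \<Phi> u v)" "mono_on {0..} (\<lambda>u. \<Phi> u v')"
      using assms that by (auto simp: triangle_function_def)
    have "\<Phi> u v \<le> \<Phi> u v'" using mono_onD[OF mono(1), of v v'] that by simp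
    also have "\<dots> \<le> \<Phi> u' v'" using mono_onD[OF mono(2), of u u'] that by simp
    finally show ?thesis .
  qed
qed

text \<open>The unknown \<open>v\<close> occurs on both sides of the hypothesis. Replacing both arguments of \<open>\<Phi>\<close> by
  the larger of \<open>u\<close> and \<open>v\<close> shows first that the larger one is \<open>u\<close>, and then the bound.\<close>

lemma implicit_step_bound:
  assumes tri: "triangle_function \<Phi>"
    and hom: "\<And>k u v. 0 \<le> k \<Longrightarrow> 0 \<le> u \<Longrightarrow> 0 \<le> v \<Longrightarrow> \<Phi> (k * u) (k * v) = k * \<Phi> u v"
    and "0 \<le> \<beta>" and small: "\<beta> * \<Phi> 1 1 < 1"
    and "0 \<le> u" "0 \<le> v" and v: "v \<le> \<beta> * \<Phi> u v"
  shows "v \<le> \<beta> * \<Phi> 1 1 * u"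
proof -
  define m where "m = max u v"
  have m: "0 \<le> m" "u \<le> m" "v \<le> m" using assms by (auto simp: m_def)
  have "v \<le> \<beta> * \<Phi> m m"
    using v mult_left_mono[OF triangle_functionD(2)[OF tri, of u m v m] \<open>0 \<le> \<beta>\<close>] m assms
    by linarith
  also have "\<Phi> m m = m * \<Phi> 1 1"
    using hom[of m 1 1] m by simp
  finally have le: "v \<le> \<beta> * \<Phi> 1 1 * m"
    by (simp add: mult_ac)
  have "m = u"
  proof (rule ccontr)
    assume "m \<noteq> u"
    then have "m = v" "0 < v" using assms by (auto simp: m_def max_def split: if_splits)
    with small have "\<beta> * \<Phi> 1 1 * m < m" by simp
    with le \<open>m = v\<close> show False by simp
  qed
  with le show ?thesis by simp
qed

section \<open>Sequences with geometric steps\<close>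

lemma dist_le_nested_from:
  assumes tri: "triangle_function \<Phi>"
    and hom: "\<And>k u v. 0 \<le> k \<Longrightarrow> 0 \<le> u \<Longrightarrow> 0 \<le> v \<Longrightarrow> \<Phi> (k * u) (k * v) = k * \<Phi> u v"
    and s: "\<And>n. s n \<in> X" and "0 \<le> a" "0 \<le> M"
    and step: "\<And>n. d (s n) (s (Suc n)) \<le> M * a ^ n"
  shows "d (s i) (s (Suc (i + n))) \<le> M * nested_from \<Phi> a i n"
proof (induction n arbitrary: i)
  case 0
  then show ?case using step by simp
next
  case (Suc n)
  note nf = nested_from_nonneg[of \<Phi> a, OF triangle_functionD(1)[OF tri] \<open>0 \<le> a\<close>]
  have "d (s i) (s (Suc (i + Suc n)))
      \<le> \<Phi> (d (s i) (s (Suc i))) (d (s (Suc i)) (s (Suc (Suc i + n))))"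
    using triangle_functionD(3)[OF tri s s s] by simp
  also have "\<dots> \<le> \<Phi> (M * a ^ i) (M * nested_from \<Phi> a (Suc i) n)"
    using Suc.IH[of "Suc i"] step[of i] nonneg s by (intro triangle_functionD(2)[OF tri]) auto
  also have "\<dots> = M * nested_from \<Phi> a i (Suc n)"
    using hom[OF \<open>0 \<le> M\<close>, of "a ^ i"] nf \<open>0 \<le> a\<close> by simp
  finally show ?case .
qed

lemma Cauchy_seq_if_dist_le_null:
  assumes s: "\<And>n. s n \<in> X"
    and le: "\<And>i n. d (s i) (s (i + n)) \<le> b i" and b: "b \<longlonglongrightarrow> 0"
  shows "Cauchy_seq s"
  unfolding Cauchy_seq_def
proof (intro conjI allI impI)
  show "range s \<subseteq> X" using s by auto
  fix \<epsilon> :: real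
  assume "0 < \<epsilon>"
  then obtain N where N: "\<And>i. N \<le> i \<Longrightarrow> b i < \<epsilon>"
    using order_tendstoD(2)[OF b, of \<epsilon>] by (auto simp: eventually_sequentially)
  have "d (s n) (s m) < \<epsilon>" if "N \<le> n" "N \<le> m" for n m
  proof (cases n m rule: le_cases)
    case le
    then show ?thesis using assms(2)[of n "m - n"] N[of n] that by simp
  next
    case ge
    then show ?thesis using assms(2)[of m "n - m"] N[of m] that commute[OF s s, of n m] by simp
  qed
  then show "\<exists>N. \<forall>n\<ge>N. \<forall>m\<ge>N. d (s n) (s m) < \<epsilon>" by blast
qed

text \<open>This plays the part of the convergence of the geometric series: the constant \<open>C\<close> stands in
  for \<open>1 / (1 - a)\<close>, the value that it takes for addition in place of \<open>\<Phi>\<close>.\<close>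

lemma Cauchy_seq_if_geometric_steps:
  assumes tri: "triangle_function \<Phi>"
    and hom: "\<And>k u v. 0 \<le> k \<Longrightarrow> 0 \<le> u \<Longrightarrow> 0 \<le> v \<Longrightarrow> \<Phi> (k * u) (k * v) = k * \<Phi> u v"
    and s: "\<And>n. s n \<in> X" and a: "0 \<le> a" "a < 1" and M: "0 \<le> M"
    and step: "\<And>n. d (s n) (s (Suc n)) \<le> M * a ^ n"
    and C: "\<And>p. 1 \<le> p \<Longrightarrow> nested \<Phi> a p \<le> C"
  shows "Cauchy_seq s"
proof (rule Cauchy_seq_if_dist_le_null[OF s])
  \<comment> \<open>The bound \<open>C\<close> is for at least one application of \<open>\<Phi>\<close>, that is, two or more steps;
     a single step needs the constant \<open>1\<close>.\<close>
  define K where "K = max C 1"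
  have K: "nested \<Phi> a p \<le> K" for p
    using C[of p] by (cases p) (auto simp: K_def nested_def)
  show "d (s i) (s (i + n)) \<le> M * (a ^ i * K)" for i n
  proof (cases n)
    case 0
    then show ?thesis
      using zero_iff[OF s s, of i i] M a by (simp add: K_def)
  next
    case (Suc p)
    have "d (s i) (s (i + n)) \<le> M * nested_from \<Phi> a i p"
      using dist_le_nested_from[OF tri hom s a(1) M step, of i p] Suc by simp
    also have "nested_from \<Phi> a i p = a ^ i * nested \<Phi> a p"
      by (rule nested_from_eq_power_mult_nested[of \<Phi>, OF triangle_functionD(1)[OF tri] hom a(1)])
    also have "M * (a ^ i * nested \<Phi> a p) \<le> M * (a ^ i * K)"
      using K M a by (intro mult_left_mono) auto
    finally show ?thesis .
  qed
  have "(\<lambda>i. M * (a ^ i * K)) \<longlonglongrightarrow> M * (0 * K)"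
    using a by (intro tendsto_intros LIMSEQ_power_zero) auto
  then show "(\<lambda>i. M * (a ^ i * K)) \<longlonglongrightarrow> 0" by simp
qed

section \<open>Chatterjea-type contractions\<close>

lemma orbit_step_le:
  assumes tri: "triangle_function \<Phi>"
    and hom: "\<And>k u v. 0 \<le> k \<Longrightarrow> 0 \<le> u \<Longrightarrow> 0 \<le> v \<Longrightarrow> \<Phi> (k * u) (k * v) = k * \<Phi> u v"
    and T: "T \<in> X \<rightarrow> X" and "0 \<le> \<beta>" and small: "\<beta> * \<Phi> 1 1 < 1"
    and contr: "\<And>x y. x \<in> X \<Longrightarrow> y \<in> X \<Longrightarrow> d (T x) (T y) \<le> \<beta> * max (d x (T y)) (d y (T x))"
    and x: "x \<in> X"
  shows "d (T x) (T (T x)) \<le> \<beta> * \<Phi> 1 1 * d x (T x)"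
proof (rule implicit_step_bound[OF tri hom \<open>0 \<le> \<beta>\<close> small])
  have T1: "T x \<in> X" and T2: "T (T x) \<in> X" using T x by auto
  show "0 \<le> d x (T x)" "0 \<le> d (T x) (T (T x))" using x T1 T2 nonneg by auto
  have "d (T x) (T (T x)) \<le> \<beta> * max (d x (T (T x))) (d (T x) (T x))"
    using contr x T1 by simp
  also have "d (T x) (T x) = 0" using zero_iff T1 by simp
  also have "max (d x (T (T x))) 0 = d x (T (T x))" using nonneg x T2 by simp
  also have "\<beta> * d x (T (T x)) \<le> \<beta> * \<Phi> (d x (T x)) (d (T x) (T (T x)))"
    using triangle_functionD(3)[OF tri x T2 T1] \<open>0 \<le> \<beta>\<close> by (rule mult_left_mono)
  finally show "d (T x) (T (T x)) \<le> \<beta> * \<Phi> (d x (T x)) (d (T x) (T (T x)))" .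
qed

text \<open>In the contraction condition at \<open>s n\<close> and \<open>x\<close>, the cross distance \<open>d x (T (s n))\<close> vanishes in
  the limit; for the other two distances, continuity of \<open>d\<close> is applied to the orbit and the
  constant sequence \<open>T x\<close>.\<close>

lemma orbit_limit_dist_le:
  assumes cont: "continuous_semimetric"
    and T: "T \<in> X \<rightarrow> X"
    and contr: "\<And>x y. x \<in> X \<Longrightarrow> y \<in> X \<Longrightarrow> d (T x) (T y) \<le> \<beta> * max (d x (T y)) (d y (T x))"
    and conv: "converges_to s x" and orbit: "\<And>n. s (Suc n) = T (s n)"
  shows "d x (T x) \<le> \<beta> * d x (T x)"
proof -
  have s: "\<And>n. s n \<in> X" and x: "x \<in> X" and lim: "(\<lambda>n. d (s n) x) \<longlonglongrightarrow> 0"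
    using conv by (auto simp: converges_to_def)
  have Tx: "T x \<in> X" using T x by auto
  have "converges_to (\<lambda>_. T x) (T x)"
    using Tx zero_iff[OF Tx Tx] by (auto simp: converges_to_def)
  with cont conv have lim_T: "(\<lambda>n. d (s n) (T x)) \<longlonglongrightarrow> d x (T x)"
    unfolding continuous_semimetric_def by blast
  have "d (s (Suc n)) (T x) \<le> \<beta> * max (d (s n) (T x)) (d (s (Suc n)) x)" for n
    using contr[OF s x, of n] commute[OF x s, of "Suc n"] orbit by simp
  moreover have "(\<lambda>n. \<beta> * max (d (s n) (T x)) (d (s (Suc n)) x)) \<longlonglongrightarrow> \<beta> * max (d x (T x)) 0"
    by (intro tendsto_intros lim_T LIMSEQ_Suc[OF lim])
  ultimately have "d x (T x) \<le> \<beta> * max (d x (T x)) 0"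
    using LIMSEQ_le[OF LIMSEQ_Suc[OF lim_T]] by blast
  then show ?thesis using nonneg[OF x Tx] by simp
qed

text \<open>If \<open>X\<close> has two points, a degenerate triangle shows \<open>\<beta> \<le> \<Phi> 0 \<beta>\<close>, so the hypothesis
  \<open>\<Phi> 0 \<beta> < 1\<close> says in particular \<open>\<beta> < 1\<close>. Using it on the two points at hand covers
  one-point spaces as well.\<close>

lemma eq_if_dist_le_mult_dist:
  assumes tri: "triangle_function \<Phi>"
    and hom: "\<And>k u v. 0 \<le> k \<Longrightarrow> 0 \<le> u \<Longrightarrow> 0 \<le> v \<Longrightarrow> \<Phi> (k * u) (k * v) = k * \<Phi> u v"
    and "0 \<le> \<beta>" "\<Phi> 0 \<beta> < 1"
    and x: "x \<in> X" and y: "y \<in> X" and le: "d x y \<le> \<beta> * d x y"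
  shows "x = y"
proof (rule ccontr)
  assume "x \<noteq> y"
  then have pos: "0 < d x y" using nonneg[OF x y] zero_iff[OF x y] by simp
  have "d x y \<le> \<Phi> (d x x) (d x y)" by (rule triangle_functionD(3)[OF tri x y x])
  also have "\<dots> \<le> \<Phi> 0 (d x y * \<beta>)"
    using le pos zero_iff[OF x x] by (intro triangle_functionD(2)[OF tri]) (auto simp: mult.commute)
  also have "\<dots> = d x y * \<Phi> 0 \<beta>" using hom[of "d x y" 0 \<beta>] pos \<open>0 \<le> \<beta>\<close> by simp
  also have "\<dots> < d x y" using pos \<open>\<Phi> 0 \<beta> < 1\<close> by simp
  finally show False by simp
qed

end

theorem theorem2p5:
  fixes X :: "'a set" and d :: "'a \<Rightarrow> 'a \<Rightarrow> real"
    and \<Phi> :: "real \<Rightarrow> real \<Rightarrow> real" and T :: "'a \<Rightarrow> 'a" and \<beta> :: real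
  assumes semimetric: "semimetric_space X d"
    and complete: "semimetric_space.complete_space X d"
    and triangle: "semimetric_space.triangle_function X d \<Phi>"
    and \<Phi>_continuous: "continuous_on ({0..} \<times> {0..}) (\<lambda>(u, v). \<Phi> u v)"
    and d_continuous: "semimetric_space.continuous_semimetric X d"
    and T_self: "T \<in> X \<rightarrow> X"
    and \<beta>_nonneg: "0 \<le> \<beta>"
    and T_contr: "\<forall>x\<in>X. \<forall>y\<in>X. d (T x) (T y) \<le> \<beta> * max (d x (T y)) (d y (T x))"
    and homogeneous: "\<forall>k\<ge>0. \<forall>u\<ge>0. \<forall>v\<ge>0. \<Phi> (k * u) (k * v) = k * \<Phi> u v"
    and nested_bound: "\<forall>a. 0 \<le> a \<and> a < 1 \<longrightarrow> (\<exists>C>0. \<forall>p\<ge>1. nested \<Phi> a p \<le> C)"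
    and \<Phi>_\<beta>: "\<Phi> 0 \<beta> < 1"
    and inverse_gt: "\<beta> > 0 \<longrightarrow> generalized_inverse (\<lambda>u. \<Phi> u 1) (1 / \<beta>) > 1"
  shows "(\<exists>x\<in>X. T x = x) \<and> (\<beta> < 1 \<longrightarrow> (\<exists>!x. x \<in> X \<and> T x = x))"
proof -
  interpret semimetric_space X d by (rule semimetric)
  note tri = triangle
  have hom: "\<Phi> (k * u) (k * v) = k * \<Phi> u v" if "0 \<le> k" "0 \<le> u" "0 \<le> v" for k u v
    using homogeneous that by blast
  have contr: "d (T x) (T y) \<le> \<beta> * max (d x (T y)) (d y (T x))" if "x \<in> X" "y \<in> X" for x y
    using T_contr that by blast
  have small: "\<beta> * \<Phi> 1 1 < 1"
  proof (cases "\<beta> = 0")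
    case False
    with \<beta>_nonneg have "\<beta> > 0" by simp
    with inverse_gt have "\<Phi> 1 1 < 1 / \<beta>"
      using less_if_less_generalized_inverse[of 1 "\<lambda>u. \<Phi> u 1"] by (simp add: one_ereal_def)
    with \<open>\<beta> > 0\<close> show ?thesis by (simp add: field_simps)
  qed simp
  define a where "a = \<beta> * \<Phi> 1 1"
  have a: "0 \<le> a" "a < 1"
    using small \<beta>_nonneg triangle_functionD(1)[OF tri, of 1 1] by (auto simp: a_def)
  obtain z where z: "z \<in> X" using nonempty by blast
  define s where "s n = (T ^^ n) z" for n
  have s: "s n \<in> X" for n
    using T_self z by (induction n) (auto simp: s_def)
  have orbit: "s (Suc n) = T (s n)" for n by (simp add: s_def)
  have step: "d (s n) (s (Suc n)) \<le> d z (T z) * a ^ n" for n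
  proof (induction n)
    case (Suc n)
    have "d (s (Suc n)) (s (Suc (Suc n))) \<le> a * d (s n) (s (Suc n))"
      using orbit_step_le[OF tri hom T_self \<beta>_nonneg small contr s, of n]
      by (simp add: orbit a_def)
    also have "\<dots> \<le> a * (d z (T z) * a ^ n)"
      using Suc.IH a(1) by (rule mult_left_mono)
    finally show ?case by (simp add: mult_ac)
  qed (simp add: s_def)
  obtain C where "\<And>p. 1 \<le> p \<Longrightarrow> nested \<Phi> a p \<le> C"
    using nested_bound a by blast
  moreover have "0 \<le> d z (T z)" using nonneg z T_self by auto
  ultimately have "Cauchy_seq s"
    by (intro Cauchy_seq_if_geometric_steps[OF tri hom s a _ step])
  with complete obtain x where conv: "converges_to s x"
    unfolding complete_space_def by blast
  then have x: "x \<in> X" by (simp add: converges_to_def)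
  note eqI = eq_if_dist_le_mult_dist[OF tri hom \<beta>_nonneg \<Phi>_\<beta>]
  have "x = T x"
    using orbit_limit_dist_le[OF d_continuous T_self contr conv orbit] x T_self
    by (intro eqI) auto
  then have "T x = x" by simp
  moreover have "y = y'" if "y \<in> X" "T y = y" "y' \<in> X" "T y' = y'" for y y'
    using contr[of y y'] commute[of y y'] that by (intro eqI) auto
  ultimately show ?thesis using x by auto
qed

end
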